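(* Let $\mathfrak{H}$ be a $d$-degenerate edge-ordered graph on $n'$ vertices and let $\mathfrak{G}$ be an edge-ordered subgraph of $\mathfrak{K}^{lex}_{n,n}$. Then \[\overline{R}_e(\mathfrak{H},\mathfrak{G}) \leq (n')^2 n^{d+1}.\]
   Context: All graphs are finite and simple; $d, n, n'$ are positive integers. An edge-ordered graph $(G,\prec)$ is a graph $G$ with a linear ordering $\prec$ of its edges, also called an edge-ordering of $G$. $(G,\prec_1)$ is an edge-ordered subgraph of $(H,\prec_2)$ if $G$ is a (not necessarily induced) subgraph of $H$ and $\prec_1$ is a suborder of $\prec_2$. Isomorphisms of edge-ordered graphs are graph isomorphisms preserving the edge-orderings; a copy of $\mathfrak{G}$ is an edge-ordered subgraph isomorphic to $\mathfrak{G}$. A graph is $d$-degenerate if every subgraph of it has a vertex of degree at most $d$; an edge-ordered graph is $d$-degenerate if its underlying graph is. An ordering $\prec$ of the edges of a graph $G=(V,E)$ is lexicographic if there is a one-to-one correspondence $f\colon V\to\{1,\dots,|V|\}$ such that any two edges $\{u,v\}$ and $\{w,t\}$ of $G$ with $f(u)<f(v)$ and $f(w)<f(t)$ satisfy $\{u,v\}\prec\{w,t\}$ if either $f(u)<f(w)$, or $f(u)=f(w)$ and $f(v)<f(t)$. For positive integers $m,n$, $\mathfrak{K}^{lex}_{m,n}$ denotes the lexicographic edge-ordering of the complete bipartite graph $K_{m,n}$ that induces a vertex-ordering in which both parts of $K_{m,n}$ form an interval. Concretely, if the parts are $a_1,\dots,a_m$ and $b_1,\dots,b_n$, with vertex order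 $a_1,\dots,a_m,b_1,\dots,b_n$, then $\{a_i,b_j\}$ precedes $\{a_k,b_l\}$ if and only if $i<k$, or $i=k$ and $j<l$. For edge-ordered graphs $\mathfrak{H}$ and $\mathfrak{G}$, the non-diagonal edge-ordered Ramsey number $\overline{R}_e(\mathfrak{H},\mathfrak{G})$ is the minimum positive integer $N$ such that there exists an edge-ordering $\mathfrak{K}_N$ of the complete graph $K_N$ on $N$ vertices such that every 2-coloring of the edges of $\mathfrak{K}_N$ with colors red and blue contains a red copy of $\mathfrak{H}$ (all edges red) or a blue copy of $\mathfrak{G}$ (all edges blue) as an edge-ordered subgraph of $\mathfrak{K}_N$. *)

theory Defs
  imports Main "HOL-Library.Extended_Nat"
begin

record 'a graph =
  verts :: "'a set"
  edges :: "'a set set"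

definition simple_graph :: "('a, 'r) graph_scheme \<Rightarrow> bool" where
  "simple_graph G \<longleftrightarrow> finite (verts G) \<and> (\<forall>e\<in>edges G. e \<subseteq> verts G \<and> card e = 2)"

definition complete_graph :: "('a, 'r) graph_scheme \<Rightarrow> bool" where
  "complete_graph G \<longleftrightarrow> finite (verts G) \<and> edges G = {e. e \<subseteq> verts G \<and> card e = 2}"

definition subgraph :: "('a, 'r) graph_scheme \<Rightarrow> ('a, 's) graph_scheme \<Rightarrow> bool" where
  "subgraph F G \<longleftrightarrow> simple_graph F \<and> verts F \<subseteq> verts G \<and> edges F \<subseteq> edges G"

definition degree :: "('a, 'r) graph_scheme \<Rightarrow> 'a \<Rightarrow> nat" where
  "degree G v = card {e \<in> edges G. v \<in> e}"

text \<open>Subgraphs without vertices are excluded here, as they contain no vertex at all.\<close>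

definition degenerate :: "nat \<Rightarrow> ('a, 'r) graph_scheme \<Rightarrow> bool" where
  "degenerate d G \<longleftrightarrow>
     (\<forall>F :: 'a graph. subgraph F G \<and> verts F \<noteq> {} \<longrightarrow> (\<exists>v\<in>verts F. degree F v \<le> d))"

text \<open>\<open>(e, e') \<in> eord G\<close> means that \<open>e\<close> strictly precedes \<open>e'\<close>.\<close>

record 'a eograph = "'a graph" +
  eord :: "('a set \<times> 'a set) set"

definition edge_ordered_graph :: "'a eograph \<Rightarrow> bool" where
  "edge_ordered_graph G \<longleftrightarrow>
     simple_graph G \<and> eord G \<subseteq> edges G \<times> edges G \<and> strict_linear_order_on (edges G) (eord G)"

definition eo_subgraph :: "'a eograph \<Rightarrow> 'a eograph \<Rightarrow> bool" where
  "eo_subgraph G H \<longleftrightarrow>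
     edge_ordered_graph G \<and> subgraph G H \<and> eord G = Restr (eord H) (edges G)"

definition eo_isomorphic :: "'a eograph \<Rightarrow> 'b eograph \<Rightarrow> bool" where
  "eo_isomorphic G H \<longleftrightarrow>
     (\<exists>f. bij_betw f (verts G) (verts H) \<and>
          (\<forall>u\<in>verts G. \<forall>v\<in>verts G. {u, v} \<in> edges G \<longleftrightarrow> {f u, f v} \<in> edges H) \<and>
          (\<forall>e\<in>edges G. \<forall>e'\<in>edges G. (e, e') \<in> eord G \<longleftrightarrow> (f ` e, f ` e') \<in> eord H))"

text \<open>\<open>eo_copy C G K\<close>: \<open>C\<close> is a copy of \<open>G\<close> in \<open>K\<close>.\<close>

definition eo_copy :: "'b eograph \<Rightarrow> 'a eograph \<Rightarrow> 'b eograph \<Rightarrow> bool" where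
  "eo_copy C G K \<longleftrightarrow> eo_subgraph C K \<and> eo_isomorphic G C"

text \<open>The parts of \<open>Klex m n\<close> are \<open>a\<^sub>i = Inl i\<close> and \<open>b\<^sub>j = Inr j\<close>, with vertex order
  \<open>a\<^sub>1, \<dots>, a\<^sub>m, b\<^sub>1, \<dots>, b\<^sub>n\<close>.\<close>

definition Klex :: "nat \<Rightarrow> nat \<Rightarrow> (nat + nat) eograph" where
  "Klex m n =
     \<lparr> verts = Inl ` {1..m} \<union> Inr ` {1..n},
       edges = {{Inl i, Inr j} | i j. i \<in> {1..m} \<and> j \<in> {1..n}},
       eord = {({Inl i, Inr j}, {Inl k, Inr l}) | i j k l.
                 i \<in> {1..m} \<and> j \<in> {1..n} \<and> k \<in> {1..m} \<and> l \<in> {1..n} \<and>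
                 (i < k \<or> i = k \<and> j < l)} \<rparr>"

datatype colour = Red | Blue

definition eo_arrows :: "'c eograph \<Rightarrow> 'a eograph \<Rightarrow> 'b eograph \<Rightarrow> bool" where
  "eo_arrows K H G \<longleftrightarrow>
     (\<forall>c :: 'c set \<Rightarrow> colour.
        (\<exists>C. eo_copy C H K \<and> (\<forall>e\<in>edges C. c e = Red)) \<or>
        (\<exists>C. eo_copy C G K \<and> (\<forall>e\<in>edges C. c e = Blue)))"

text \<open>The minimum is taken in \<^typ>\<open>enat\<close>, so it is \<open>\<infinity>\<close> if no suitable \<open>N\<close> exists; an upper bound
  by a natural number thus includes the existence of such an \<open>N\<close>.\<close>

definition eo_ramsey :: "'a eograph \<Rightarrow> 'b eograph \<Rightarrow> enat" where
  "eo_ramsey H G =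
     Inf {enat N | N. N > 0 \<and>
       (\<exists>K :: nat eograph. edge_ordered_graph K \<and> complete_graph K \<and> verts K = {1..N} \<and>
          eo_arrows K H G)}"

end

theory Submission
  imports Defs "HOL-Library.Infinite_Set" "HOL-Library.Product_Lexorder"
begin

text \<open>Order the vertices of \<open>H\<close> so that each has at most \<open>d\<close> neighbours before it, and give each of
  them a block of \<open>n' n\<^sup>d\<^sup>+\<^sup>1\<close> vertices of the complete graph. Edges between two blocks are compared
  first by the rank of the corresponding edge of \<open>H\<close> and then lexicographically. Thus every
  transversal copy of the unordered graph \<open>H\<close> is correctly edge-ordered, and so is every complete
  bipartite graph between two blocks. Embed the vertices of \<open>H\<close> greedily in red, keeping for every
  later vertex a set of candidates, which loses a factor \<open>n\<close> whenever one of its neighbours is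
  embedded. A vertex is bad for a later neighbour if it has too few red neighbours among the
  candidates of the latter; \<open>n\<close> bad vertices for the same neighbour span a blue \<open>K\<^sub>n\<^sub>,\<^sub>n\<close> together
  with \<open>n\<close> of the candidates.\<close>

section \<open>Copies inside an edge-ordered graph\<close>

text \<open>Preserving the order in one direction is enough: both orders are strict and linear on
  the edges, so a map that preserves precedence also reflects it. The copy carries the image edges
  only, so other edges of \<open>K\<close> on the image do no harm, and the equation for
  \<open>edges C\<close> lets colours be checked edge by edge of \<open>H\<close>.\<close>

lemma eo_copy_image:
  fixes H :: "'a eograph" and K :: "'b eograph"
  assumes H: "edge_ordered_graph H" and K: "edge_ordered_graph K"
    and inj: "inj_on f (verts H)" and verts: "f ` verts H \<subseteq> verts K"
    and edges: "\<And>e. e \<in> edges H \<Longrightarrow> f ` e \<in> edges K"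
    and mono: "\<And>e e'. (e, e') \<in> eord H \<Longrightarrow> (f ` e, f ` e') \<in> eord K"
  obtains C where "eo_copy C H K" "edges C = (`) f ` edges H"
proof -
  define E where "E = (`) f ` edges H"
  define C :: "'b eograph" where
    "C = \<lparr>verts = f ` verts H, edges = E, eord = Restr (eord K) E\<rparr>"
  have simpH: "finite (verts H)" "\<And>e. e \<in> edges H \<Longrightarrow> e \<subseteq> verts H \<and> card e = 2"
    using H by (auto simp: edge_ordered_graph_def simple_graph_def)
  have E_K: "E \<subseteq> edges K"
    using edges by (auto simp: E_def)
  have simpC: "simple_graph C"
    using simpH inj unfolding simple_graph_def C_def E_def
    by (auto simp: card_image inj_on_subset)
  have linK: "strict_linear_order_on (edges K) (eord K)"
    using K by (simp add: edge_ordered_graph_def)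
  have "total_on E (Restr (eord K) E)"
    using linK E_K unfolding strict_linear_order_on_def total_on_def by blast
  then have "strict_linear_order_on E (Restr (eord K) E)"
    using linK by (auto simp: strict_linear_order_on_def irrefl_def intro: trans_Restr)
  then have sub: "eo_subgraph C K"
    using simpC verts E_K
    by (auto simp: eo_subgraph_def edge_ordered_graph_def subgraph_def C_def)
  have edge_iff: "{u, v} \<in> edges H \<longleftrightarrow> {f u, f v} \<in> edges C" if "u \<in> verts H" "v \<in> verts H" for u v
  proof
    assume "{u, v} \<in> edges H"
    then have "f ` {u, v} \<in> E" unfolding E_def by (rule imageI)
    then show "{f u, f v} \<in> edges C" by (simp add: C_def)
  next
    assume "{f u, f v} \<in> edges C"
    then obtain e where e: "e \<in> edges H" "f ` {u, v} = f ` e" by (auto simp: C_def E_def)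
    then have "{u, v} = e"
      using inj_on_image_eq_iff[OF inj, of "{u, v}" e] simpH that by auto
    with e show "{u, v} \<in> edges H" by simp
  qed
  have linH: "strict_linear_order_on (edges H) (eord H)" and "eord H \<subseteq> edges H \<times> edges H"
    using H by (auto simp: edge_ordered_graph_def)
  have ord_iff: "(e, e') \<in> eord H \<longleftrightarrow> (f ` e, f ` e') \<in> eord C"
    if "e \<in> edges H" "e' \<in> edges H" for e e'
  proof
    assume "(e, e') \<in> eord H"
    then show "(f ` e, f ` e') \<in> eord C" using mono that by (auto simp: C_def E_def)
  next
    assume "(f ` e, f ` e') \<in> eord C"
    then have *: "(f ` e, f ` e') \<in> eord K" by (simp add: C_def)
    have "trans (eord K)" "irrefl (eord K)"
      using linK by (auto simp: strict_linear_order_on_def)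
    then have "e \<noteq> e'" "(e', e) \<notin> eord H"
      using * mono by (auto simp: irrefl_def dest: transD)
    then show "(e, e') \<in> eord H"
      using linH that by (auto simp: strict_linear_order_on_def total_on_def)
  qed
  have "eo_isomorphic H C"
    unfolding eo_isomorphic_def
    using inj edge_iff ord_iff by (intro exI[of _ f]) (auto simp: bij_betw_def C_def)
  with sub show ?thesis
    using that[of C] by (simp add: eo_copy_def C_def E_def)
qed

section \<open>Degeneracy orders\<close>

text \<open>Peel vertices off from the end: a vertex of degree at most \<open>d\<close> in the
  subgraph induced by the current set comes last, and induction orders the others.\<close>

lemma degeneracy_order:
  fixes H :: "('a, 'r) graph_scheme"
  assumes H: "simple_graph H" and deg: "degenerate d H"
  obtains g where "bij_betw g (verts H) {..<card (verts H)}"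
    and "\<And>v. v \<in> verts H \<Longrightarrow> card {u \<in> verts H. {u, v} \<in> edges H \<and> g u < g v} \<le> d"
proof -
  have fin: "finite (verts H)" using H by (simp add: simple_graph_def)
  have "\<exists>g. bij_betw g S {..<card S} \<and>
      (\<forall>v\<in>S. card {u \<in> S. {u, v} \<in> edges H \<and> g u < g v} \<le> d)" if "S \<subseteq> verts H" for S
    using that
  proof (induction "card S" arbitrary: S)
    case 0
    then have "S = {}" using fin finite_subset by fastforce
    then show ?case by (auto simp: bij_betw_def)
  next
    case (Suc k)
    have finS: "finite S" using Suc fin finite_subset by blast
    define F :: "'a graph" where "F = \<lparr>verts = S, edges = {e \<in> edges H. e \<subseteq> S}\<rparr>"
    have "subgraph F H" "verts F \<noteq> {}"
      using Suc H finS by (auto simp: F_def subgraph_def simple_graph_def)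
    then obtain v where "v \<in> verts F" "degree F v \<le> d"
      using deg unfolding degenerate_def by blast
    then have v: "v \<in> S" "degree F v \<le> d" by (simp_all add: F_def)
    have cardS: "card (S - {v}) = k" using Suc v finS by simp
    then obtain g where g: "bij_betw g (S - {v}) {..<k}"
      and few_back: "\<And>w. w \<in> S - {v} \<Longrightarrow> card {u \<in> S - {v}. {u, w} \<in> edges H \<and> g u < g w} \<le> d"
      using Suc.hyps(1)[of "S - {v}"] Suc.prems by auto
    \<comment> \<open>With \<open>v\<close> in the last position, its earlier neighbours are all its
      neighbours in \<open>F\<close>, at most \<open>d\<close> of them. For any other vertex,
      \<open>v\<close> comes later and does not enter the count.\<close>
    define g' where "g' = g(v := k)"
    have "bij_betw g' (S - {v}) {..<k}"
      using g by (rule bij_betw_cong[THEN iffD1, rotated]) (auto simp: g'_def)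
    then have "bij_betw g' (insert v (S - {v})) (insert (g' v) {..<k})"
      by (intro notIn_Un_bij_betw[of _ _ g', simplified]) (auto simp: g'_def)
    then have bij: "bij_betw g' S {..<card S}"
      using v Suc.hyps(2) by (simp add: insert_absorb g'_def lessThan_Suc flip: Suc.hyps(2))
    have lt: "g w < k" if "w \<in> S - {v}" for w
      using g that by (auto simp: bij_betw_def)
    have "card {u \<in> S. {u, w} \<in> edges H \<and> g' u < g' w} \<le> d" if w: "w \<in> S" for w
    proof (cases "w = v")
      case True
      have "card {u \<in> S. {u, v} \<in> edges H \<and> g' u < g' v} \<le> card {e \<in> edges F. v \<in> e}"
      proof (rule card_inj_on_le[of "\<lambda>u. {u, v}"])
        show "inj_on (\<lambda>u. {u, v}) {u \<in> S. {u, v} \<in> edges H \<and> g' u < g' v}"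
          by (auto simp: inj_on_def doubleton_eq_iff)
        show "(\<lambda>u. {u, v}) ` {u \<in> S. {u, v} \<in> edges H \<and> g' u < g' v} \<subseteq> {e \<in> edges F. v \<in> e}"
          using v by (auto simp: F_def)
        show "finite {e \<in> edges F. v \<in> e}"
          by (rule finite_subset[of _ "Pow S"]) (use finS in \<open>auto simp: F_def\<close>)
      qed
      then show ?thesis using v True by (simp add: degree_def)
    next
      case False
      then have "{u \<in> S. {u, w} \<in> edges H \<and> g' u < g' w}
          = {u \<in> S - {v}. {u, w} \<in> edges H \<and> g u < g w}"
        using lt[of w] w by (auto simp: g'_def)
      then show ?thesis using few_back[of w] w False by simp
    qed
    then show ?case using bij by auto
  qed
  from this[of "verts H"] show ?thesis using that by auto
qed

section \<open>Greedy embedding\<close>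

text \<open>Otherwise take \<open>n\<close> bad vertices. Each is related to at most
  \<open>M - 1\<close> elements of \<open>C\<close>, so together they miss at least
  \<open>M * n - n * (M - 1) = n\<close> elements, and \<open>n\<close> of these contradict
  \<open>free\<close>.\<close>

lemma few_bad_vertices:
  assumes C: "finite C" "card C = M * n" and M: "M \<ge> 1"
    and free: "\<And>A B. A \<subseteq> D \<Longrightarrow> B \<subseteq> C \<Longrightarrow> card A = n \<Longrightarrow> card B = n \<Longrightarrow> \<exists>a\<in>A. \<exists>b\<in>B. R a b"
  shows "card {x \<in> D. card {y \<in> C. R x y} < M} < n"
proof (rule ccontr)
  assume "\<not> ?thesis"
  then have "n \<le> card {x \<in> D. card {y \<in> C. R x y} < M}" by simp
  then obtain A where A: "A \<subseteq> {x \<in> D. card {y \<in> C. R x y} < M}" "card A = n" "finite A"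
    by (rule obtain_subset_with_card_n)
  define U where "U = (\<Union>x\<in>A. {y \<in> C. R x y})"
  have "card U \<le> (\<Sum>x\<in>A. card {y \<in> C. R x y})"
    unfolding U_def using A by (intro card_UN_le)
  also have "\<dots> \<le> (\<Sum>x\<in>A. M - 1)"
    using A by (intro sum_mono) auto
  finally have "card U \<le> M * n - n" using A by (simp add: algebra_simps)
  moreover have "n \<le> M * n" using M by simp
  moreover have "card (C - U) = M * n - card U"
    using C by (subst card_Diff_subset) (auto simp: U_def intro: finite_subset)
  ultimately have "n \<le> card (C - U)" by linarith
  then obtain B where "B \<subseteq> C - U" "card B = n"
    by (rule obtain_subset_with_card_n)
  then show False using free[of A B] A by (auto simp: U_def)
qed

text \<open>In the application \<open>R\<close> is red adjacency, \<open>V j\<close> is the block of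
  the \<open>j\<close>-th vertex in a degeneracy order, and \<open>free\<close> says that no two
  adjacent blocks span a blue complete bipartite graph with parts of size \<open>n\<close>. At most
  \<open>d\<close> neighbours precede \<open>j\<close>, each costing a factor \<open>n\<close>, so
  \<open>m * n\<close> candidates survive until \<open>j\<close> is embedded; fewer than
  \<open>m\<close> later neighbours rule out fewer than \<open>n\<close> of them each.\<close>

lemma greedy_embedding:
  fixes V :: "nat \<Rightarrow> 'v set" and m n d :: nat
  assumes n: "n \<ge> 1"
    and V: "\<And>j. j < m \<Longrightarrow> finite (V j) \<and> card (V j) = m * n * n ^ d"
    and few_back: "\<And>j. j < m \<Longrightarrow> card {i. i < j \<and> adj i j} \<le> d"
    and free: "\<And>i j A B. i < j \<Longrightarrow> j < m \<Longrightarrow> adj i j \<Longrightarrow> A \<subseteq> V i \<Longrightarrow> B \<subseteq> V j \<Longrightarrow>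
      card A = n \<Longrightarrow> card B = n \<Longrightarrow> \<exists>a\<in>A. \<exists>b\<in>B. R a b"
  obtains f where "\<And>i. i < m \<Longrightarrow> f i \<in> V i"
    and "\<And>i j. i < j \<Longrightarrow> j < m \<Longrightarrow> adj i j \<Longrightarrow> R (f i) (f j)"
proof -
  \<comment> \<open>The number of neighbours of \<open>j\<close> already embedded after
    \<open>k\<close> steps, hence the number of factors \<open>n\<close> lost by its candidate
    set.\<close>
  define c where "c k j = card {i. i < k \<and> adj i j}" for k j
  have c_Suc: "c (Suc k) j = (if adj k j then Suc (c k j) else c k j)" for k j
  proof -
    have "{i. i < Suc k \<and> adj i j} =
        (if adj k j then insert k {i. i < k \<and> adj i j} else {i. i < k \<and> adj i j})"
      by (auto simp: less_Suc_eq)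
    then show ?thesis by (simp add: c_def)
  qed
  have c_le: "c k j \<le> d" if "k \<le> j" "j < m" for k j
  proof -
    have "c k j \<le> card {i. i < j \<and> adj i j}"
      unfolding c_def using that by (intro card_mono) auto
    then show ?thesis using few_back[of j] that by simp
  qed
  \<comment> \<open>The invariant after \<open>k\<close> steps: every remaining candidate for
    \<open>j\<close> is compatible with all embedded neighbours of \<open>j\<close>, so any choice
    from \<open>C j\<close> is safe with respect to the past.\<close>
  have "\<exists>f C. (\<forall>i<k. f i \<in> V i) \<and> (\<forall>j<k. \<forall>i<j. adj i j \<longrightarrow> R (f i) (f j)) \<and>
      (\<forall>j. k \<le> j \<and> j < m \<longrightarrow> C j \<subseteq> V j \<and> card (C j) = m * n * n ^ (d - c k j) \<and>
        (\<forall>i<k. adj i j \<longrightarrow> (\<forall>y\<in>C j. R (f i) y)))" if "k \<le> m" for k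
    using that
  proof (induction k)
    case 0
    show ?case by (intro exI[of _ undefined] exI[of _ V]) (use V in \<open>auto simp: c_def\<close>)
  next
    case (Suc k)
    then obtain f C where inv: "\<forall>i<k. f i \<in> V i" "\<forall>j<k. \<forall>i<j. adj i j \<longrightarrow> R (f i) (f j)"
      "\<forall>j. k \<le> j \<and> j < m \<longrightarrow> C j \<subseteq> V j \<and> card (C j) = m * n * n ^ (d - c k j) \<and>
        (\<forall>i<k. adj i j \<longrightarrow> (\<forall>y\<in>C j. R (f i) y))"
      using Suc_leD by blast
    have fV: "f i \<in> V i" if "i < k" for i
      using inv(1) that by blast
    have fR: "R (f i) (f j)" if "j < k" "i < j" "adj i j" for i j
      using inv(2) that by blast
    have C: "C j \<subseteq> V j" "card (C j) = m * n * n ^ (d - c k j)" if "k \<le> j" "j < m" for j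
      using inv(3) that by auto
    have CR: "R (f i) y" if "k \<le> j" "j < m" "i < k" "adj i j" "y \<in> C j" for i j y
      using inv(3) that by blast
    have km: "k < m" using Suc.prems by simp
    have finC: "finite (C j)" if "k \<le> j" "j < m" for j
      using C(1)[OF that] V that finite_subset by blast
    define J where "J = {j. k < j \<and> j < m \<and> adj k j}"
    define M where "M j = m * n * n ^ (d - c (Suc k) j)" for j
    define bad where "bad j = {x \<in> C k. card {y \<in> C j. R x y} < M j}" for j
    have "card (bad j) \<le> n" if "j \<in> J" for j
    proof -
      have j: "k < j" "j < m" "adj k j" using that by (auto simp: J_def)
      \<comment> \<open>This bound keeps the subtraction in the exponent from being truncated, so
        that the exponent really drops by one.\<close>
      have "c (Suc k) j \<le> d" using c_le j by simp
      then have "n ^ (d - c k j) = n ^ (d - c (Suc k) j) * n"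
        using j by (simp add: c_Suc Suc_diff_Suc flip: power_Suc2)
      then have "card (C j) = M j * n" using C(2)[of j] j by (simp add: M_def)
      moreover have "M j \<ge> 1" using n km by (simp add: M_def Suc_le_eq)
      ultimately have "card (bad j) < n"
        unfolding bad_def
        using j finC[of j] C(1)[of j] C(1)[of k] km free[of k j]
        by (intro few_bad_vertices) (auto dest: subset_trans)
      then show ?thesis by simp
    qed
    moreover have cardJ: "card J < m"
    proof -
      have "card J \<le> card {k<..<m}" unfolding J_def by (intro card_mono) auto
      then show ?thesis using km by simp
    qed
    moreover have "finite J" by (simp add: J_def)
    ultimately have "card (\<Union>j\<in>J. bad j) \<le> card J * n"
      using card_UN_le[of J bad] sum_bounded_above[of J "\<lambda>j. card (bad j)" n] by simp
    also have "\<dots> < m * n" using cardJ n by simp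
    also have "\<dots> \<le> card (C k)" using C(2)[of k] n km by simp
    finally have "\<not> C k \<subseteq> (\<Union>j\<in>J. bad j)"
      using card_mono[of "\<Union>j\<in>J. bad j" "C k"] \<open>finite J\<close> finC[of k] km
      by (auto simp: bad_def not_le[symmetric])
    then obtain x where "x \<in> C k" "x \<notin> (\<Union>j\<in>J. bad j)" by blast
    then have x: "x \<in> C k" "\<And>j. j \<in> J \<Longrightarrow> M j \<le> card {y \<in> C j. R x y}"
      by (auto simp: bad_def not_less)
    \<comment> \<open>Candidate sets are trimmed to size exactly \<open>M j\<close>, since the
      invariant and \<open>few_bad_vertices\<close> ask for equality. Without adjacency nothing is
      lost and \<open>C j\<close> itself serves.\<close>
    have "\<exists>D\<subseteq>C j. card D = M j \<and> (adj k j \<longrightarrow> (\<forall>y\<in>D. R x y))" if "k < j" "j < m" for j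
    proof (cases "adj k j")
      case True
      then have "M j \<le> card {y \<in> C j. R x y}" using x(2) that by (simp add: J_def)
      then obtain D where "D \<subseteq> {y \<in> C j. R x y}" "card D = M j"
        by (rule obtain_subset_with_card_n)
      then show ?thesis by blast
    next
      case False
      then show ?thesis using C(2)[of j] that by (auto simp: M_def c_Suc)
    qed
    then obtain C' where C': "\<And>j. k < j \<Longrightarrow> j < m \<Longrightarrow> C' j \<subseteq> C j"
      "\<And>j. k < j \<Longrightarrow> j < m \<Longrightarrow> card (C' j) = M j"
      "\<And>j y. k < j \<Longrightarrow> j < m \<Longrightarrow> adj k j \<Longrightarrow> y \<in> C' j \<Longrightarrow> R x y"
      by metis
    show ?case
    proof (intro exI[of _ "f(k := x)"] exI[of _ C'] conjI allI impI)
      fix i assume "i < Suc k"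
      then show "(f(k := x)) i \<in> V i" using fV x(1) C(1)[of k] km by (auto simp: less_Suc_eq)
    next
      fix i j assume "j < Suc k" "i < j" "adj i j"
      then show "R ((f(k := x)) i) ((f(k := x)) j)"
        using fR CR[of k i x] x(1) km by (auto simp: less_Suc_eq)
    next
      fix j assume "Suc k \<le> j \<and> j < m"
      then show "C' j \<subseteq> V j" "card (C' j) = m * n * n ^ (d - c (Suc k) j)"
        using C'(1,2)[of j] C(1)[of j] by (auto simp: M_def)
    next
      fix i j assume "Suc k \<le> j \<and> j < m" "i < Suc k" "adj i j"
      then show "\<forall>y\<in>C' j. R ((f(k := x)) i) y"
        using C'(1,3)[of j] CR[of j i] by (auto simp: less_Suc_eq)
    qed
  qed
  from this[of m] show ?thesis using that by auto
qed

section \<open>Sort keys, ranks and enumerations\<close>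

lemma strict_linear_order_on_key:
  fixes w :: "'e \<Rightarrow> 'k :: linorder"
  assumes "inj_on w E"
  shows "strict_linear_order_on E {(e, e'). e \<in> E \<and> e' \<in> E \<and> w e < w e'}"
  using assms
  by (fastforce simp: strict_linear_order_on_def trans_def irrefl_def total_on_def inj_on_def)

text \<open>Counting predecessors turns the edge-ordering into numbers that can enter a sort key.
  The inclusion of predecessor sets is strict because \<open>e\<close> lies only in the larger
  one.\<close>

lemma strict_order_rank_less:
  assumes "finite E" "r \<subseteq> E \<times> E" "trans r" "irrefl r" "(e, e') \<in> r"
  shows "card {x. (x, e) \<in> r} < card {x. (x, e') \<in> r}"
proof (rule psubset_card_mono)
  show "finite {x. (x, e') \<in> r}" using assms(1,2) by (auto intro: finite_subset)
  show "{x. (x, e) \<in> r} \<subset> {x. (x, e') \<in> r}"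
    using assms(3-5) by (auto simp: irrefl_def dest: transD)
qed

text \<open>The indices start at 1 to match the parts of \<open>Klex\<close>;
  \<open>n \<ge> 1\<close> excludes infinite sets, whose \<open>card\<close> is 0.\<close>

lemma ex_strict_mono_enum:
  fixes A :: "nat set"
  assumes "card A = n" "n \<ge> 1"
  obtains a where "bij_betw a {1..n} A" "strict_mono_on {1..n} a"
proof -
  have fin: "finite A" using assms by (metis card.infinite not_one_le_zero)
  obtain h where h: "bij_betw h {..<n} A" "strict_mono_on {..<n} h"
    using ex_bij_betw_strict_mono_card[OF fin, unfolded assms(1)] .
  have "bij_betw (\<lambda>i. i - 1) {1..n} {..<n}"
    by (rule bij_betw_byWitness[where f' = Suc]) auto
  then have "bij_betw (h \<circ> (\<lambda>i. i - 1)) {1..n} A"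
    using h(1) by (rule bij_betw_trans)
  moreover have "strict_mono_on {1..n} (h \<circ> (\<lambda>i. i - 1))"
    by (intro strict_mono_onI) (auto intro!: strict_mono_onD[OF h(2)])
  ultimately show ?thesis by (rule that)
qed

section \<open>The edge-ordering of the complete graph and the Ramsey bound\<close>

theorem theorem6:
  fixes H :: "'a eograph" and G :: "(nat + nat) eograph" and d n n' :: nat
  assumes "d \<ge> 1" and "n \<ge> 1" and "n' \<ge> 1"
    and "edge_ordered_graph H" and "degenerate d H" and "card (verts H) = n'"
    and "eo_subgraph G (Klex n n)"
  shows "eo_ramsey H G \<le> enat (n'\<^sup>2 * n ^ (d + 1))"
proof -
  have simpH: "simple_graph H" and ordH: "eord H \<subseteq> edges H \<times> edges H"
    and linH: "trans (eord H)" "irrefl (eord H)"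
    using assms(4) by (auto simp: edge_ordered_graph_def strict_linear_order_on_def)
  have finE: "finite (edges H)"
    using simpH by (intro finite_subset[of "edges H" "Pow (verts H)"]) (auto simp: simple_graph_def)
  obtain g where g: "bij_betw g (verts H) {..<n'}"
    and few_back: "\<And>v. v \<in> verts H \<Longrightarrow> card {u \<in> verts H. {u, v} \<in> edges H \<and> g u < g v} \<le> d"
    using degeneracy_order[OF simpH assms(5), unfolded assms(6)] by blast
  define h where "h = inv_into (verts H) g"
  have hg: "h (g v) = v" if "v \<in> verts H" for v
    using g that by (auto simp: h_def bij_betw_def)
  have gh: "g (h i) = i" "h i \<in> verts H" if "i < n'" for i
    using g that by (auto simp: h_def bij_betw_def f_inv_into_f inv_into_into)
  \<comment> \<open>The size that \<open>greedy_embedding\<close> demands of each set when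
    \<open>m\<close> is \<open>n'\<close>; \<open>n'\<close> such blocks give the claimed
    total.\<close>
  define B where "B = n' * n * n ^ d"
  define N where "N = n' * B"
  have B: "B > 0" using assms(2,3) by (simp add: B_def)
  \<comment> \<open>Blocks are indexed from 0 but vertices from 1, hence the shift by one here and
    in \<open>p\<close>, which recovers the block of a vertex.\<close>
  define V where "V i = {i * B + 1..i * B + B}" for i
  define p where "p x = (x - 1) div B" for x
  have p: "p x = i" if "x \<in> V i" for x i
  proof -
    define r where "r = x - (i * B + 1)"
    have "x = i * B + 1 + r" "r < B" using that by (auto simp: V_def r_def)
    then show ?thesis by (simp add: p_def)
  qed
  have V_sub: "V i \<subseteq> {1..N}" if "i < n'" for i
  proof -
    have "Suc i * B \<le> N" using that unfolding N_def by (intro mult_right_mono) auto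
    then show ?thesis by (auto simp: V_def)
  qed
  have V_less: "x < y" if "x \<in> V i" "y \<in> V j" "i < j" for x y i j
  proof -
    have "Suc i * B \<le> j * B" using that by (intro mult_right_mono) auto
    then show ?thesis using that by (auto simp: V_def)
  qed
  \<comment> \<open>Sets that are not edges of \<open>H\<close>, among them the singletons that
    arise from edges inside one block, have no predecessors and get rank 0.\<close>
  define rk where "rk e = card {e'. (e', e) \<in> eord H}" for e
  \<comment> \<open>\<open>h \<circ> p\<close> sends a vertex to the vertex of \<open>H\<close> that
    owns its block. Edges between the same two blocks agree in the first component, so the endpoints
    order them lexicographically; the endpoints also make the key injective.\<close>
  define w where "w e = (rk ((h \<circ> p) ` e), Min e, Max e)" for e
  define E where "E = {e. e \<subseteq> {1..N} \<and> card e = 2}"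
  define K :: "nat eograph" where
    "K = \<lparr>verts = {1..N}, edges = E, eord = {(e, e'). e \<in> E \<and> e' \<in> E \<and> w e < w e'}\<rparr>"
  have "inj_on w E"
  proof (rule inj_on_inverseI[where g = "\<lambda>(_, x, y). {x, y}"])
    fix e assume "e \<in> E"
    then obtain x y where "e = {x, y}" by (auto simp: E_def card_2_iff)
    then show "(\<lambda>(_, x, y). {x, y}) (w e) = e" by (auto simp: w_def min_def max_def)
  qed
  then have K: "edge_ordered_graph K"
    using strict_linear_order_on_key[of w E]
    by (auto simp: edge_ordered_graph_def simple_graph_def K_def E_def)
  have "eo_arrows K H G"
    unfolding eo_arrows_def
  proof (intro allI disjCI)
    fix c :: "nat set \<Rightarrow> colour"
    assume no_blue: "\<nexists>C. eo_copy C G K \<and> (\<forall>e\<in>edges C. c e = Blue)"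
    define R where "R x y \<longleftrightarrow> c {x, y} = Red" for x y
    define adj where "adj i j \<longleftrightarrow> {h i, h j} \<in> edges H" for i j
    have free: "\<exists>x\<in>X. \<exists>y\<in>Y. R x y"
      if ij: "i < j" "j < n'" and X: "X \<subseteq> V i" "card X = n" and Y: "Y \<subseteq> V j" "card Y = n"
      for i j X Y
    proof (rule ccontr)
      assume "\<not> ?thesis"
      then have blue: "c {x, y} = Blue" if "x \<in> X" "y \<in> Y" for x y
        using that by (auto simp: R_def intro: colour.exhaust)
      obtain a where a: "bij_betw a {1..n} X" "strict_mono_on {1..n} a"
        using ex_strict_mono_enum[OF X(2) assms(2)] .
      obtain b where b: "bij_betw b {1..n} Y" "strict_mono_on {1..n} b"
        using ex_strict_mono_enum[OF Y(2) assms(2)] .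
      define q where "q = case_sum a b"
      have aX: "a k \<in> X" "a k \<in> V i" if "k \<in> {1..n}" for k using a X that by (auto simp: bij_betw_def)
      have bY: "b k \<in> Y" "b k \<in> V j" if "k \<in> {1..n}" for k using b Y that by (auto simp: bij_betw_def)
      have less: "a k < b l" if "k \<in> {1..n}" "l \<in> {1..n}" for k l
        using V_less aX bY ij that by blast
      \<comment> \<open>The rank is constant here and the end in \<open>X\<close> is always the
        smaller one, so with \<open>a\<close> and \<open>b\<close> increasing the keys are ordered
        as the edges of \<open>Klex n n\<close>.\<close>
      have w: "w {a k, b l} = (rk {h i, h j}, a k, b l)" if "k \<in> {1..n}" "l \<in> {1..n}" for k l
        using less[OF that] p aX(2)[OF that(1)] p bY(2)[OF that(2)] by (simp add: w_def)
      have inE: "{a k, b l} \<in> E" if "k \<in> {1..n}" "l \<in> {1..n}" for k l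
        using less[OF that] aX(2)[OF that(1)] bY(2)[OF that(2)] V_sub[of i] V_sub[of j] ij
        by (auto simp: E_def)
      have G: "edge_ordered_graph G" "verts G \<subseteq> verts (Klex n n)" "edges G \<subseteq> edges (Klex n n)"
        "eord G \<subseteq> eord (Klex n n)"
        using assms(7) by (auto simp: eo_subgraph_def subgraph_def)
      obtain C where C: "eo_copy C G K" "edges C = (`) q ` edges G"
      proof (rule eo_copy_image[OF G(1) K, of q])
        have "inj_on q (verts (Klex n n))"
        proof (rule inj_onI)
          fix s t assume st: "s \<in> verts (Klex n n)" "t \<in> verts (Klex n n)" "q s = q t"
          have "inj_on a {1..n}" "inj_on b {1..n}" using a b by (simp_all add: bij_betw_def)
          \<comment> \<open>The two instances of \<open>less\<close> refute the mixed cases, where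
            \<open>s\<close> and \<open>t\<close> lie in different parts.\<close>
          then show "s = t"
            using st less[of "projl s" "projr t"] less[of "projl t" "projr s"]
            by (cases s; cases t) (auto simp: Klex_def q_def dest: inj_onD)
        qed
        then show "inj_on q (verts G)" using G(2) inj_on_subset by blast
        have "q ` verts (Klex n n) \<subseteq> verts K"
          using aX(2) bY(2) V_sub[of i] V_sub[of j] ij by (fastforce simp: Klex_def q_def K_def)
        then show "q ` verts G \<subseteq> verts K" using G(2) by blast
      next
        fix e assume "e \<in> edges G"
        then have "e \<in> edges (Klex n n)" using G(3) by blast
        then show "q ` e \<in> edges K" using inE by (auto simp: Klex_def q_def K_def)
      next
        fix e e' assume "(e, e') \<in> eord G"
        then have "(e, e') \<in> eord (Klex n n)" using G(4) by blast
        then obtain k l k' l' where e: "e = {Inl k, Inr l}" "e' = {Inl k', Inr l'}"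
          and kl: "k \<in> {1..n}" "l \<in> {1..n}" "k' \<in> {1..n}" "l' \<in> {1..n}"
          and lt: "k < k' \<or> k = k' \<and> l < l'"
          by (auto simp: Klex_def)
        have "a k < a k' \<or> a k = a k' \<and> b l < b l'"
          using lt kl a(2) b(2) by (auto simp: strict_mono_on_def)
        then have "w {a k, b l} < w {a k', b l'}" using w kl by (auto simp: less_prod_def)
        then show "(q ` e, q ` e') \<in> eord K" using e kl inE by (auto simp: K_def q_def)
      qed
      have "c e = Blue" if e: "e \<in> edges C" for e
      proof -
        obtain e0 where "e0 \<in> edges G" "e = q ` e0" using e C(2) by auto
        moreover from this have "e0 \<in> edges (Klex n n)" using G(3) by blast
        ultimately show ?thesis using blue aX(1) bY(1) by (auto simp: Klex_def q_def)
      qed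
      then show False using no_blue C(1) by blast
    qed
    have few_back_index: "card {i. i < j \<and> adj i j} \<le> d" if "j < n'" for j
    proof -
      define U where "U = {u \<in> verts H. {u, h j} \<in> edges H \<and> g u < g (h j)}"
      have "{i. i < j \<and> adj i j} \<subseteq> g ` U"
      proof
        fix i assume "i \<in> {i. i < j \<and> adj i j}"
        then have "h i \<in> U" "i = g (h i)"
          using gh that by (simp_all add: adj_def U_def)
        then show "i \<in> g ` U" by blast
      qed
      moreover have "finite U" using simpH by (simp add: simple_graph_def U_def)
      ultimately have "card {i. i < j \<and> adj i j} \<le> card U" by (rule surj_card_le[rotated])
      also have "\<dots> \<le> d" unfolding U_def using few_back[OF gh(2)[OF that]] .
      finally show ?thesis .
    qed
    have cardV: "finite (V j) \<and> card (V j) = n' * n * n ^ d" for j by (simp add: V_def B_def)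
    obtain f where f: "\<And>i. i < n' \<Longrightarrow> f i \<in> V i"
      and red: "\<And>i j. i < j \<Longrightarrow> j < n' \<Longrightarrow> adj i j \<Longrightarrow> R (f i) (f j)"
    proof (rule greedy_embedding[OF assms(2) cardV])
      show "card {i. i < j \<and> adj i j} \<le> d" if "j < n'" for j using few_back_index[OF that] .
      show "\<exists>x\<in>X. \<exists>y\<in>Y. R x y"
        if "i < j" "j < n'" "adj i j" "X \<subseteq> V i" "Y \<subseteq> V j" "card X = n" "card Y = n" for i j X Y
        using free[OF that(1,2,4,6,5,7)] .
    qed blast
    have g_less: "g v < n'" if "v \<in> verts H" for v using g that by (auto simp: bij_betw_def)
    define q where "q = f \<circ> g"
    have hpq: "h (p (q v)) = v" if "v \<in> verts H" for v
      using p[OF f[OF g_less[OF that]]] hg[OF that] by (simp add: q_def)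
    have q_inj: "inj_on q (verts H)" by (rule inj_on_inverseI[of _ "h \<circ> p"]) (simp add: hpq)
    have q_verts: "q ` verts H \<subseteq> {1..N}"
    proof
      fix x assume "x \<in> q ` verts H"
      then obtain v where "v \<in> verts H" "x = f (g v)" by (auto simp: q_def)
      then show "x \<in> {1..N}" using V_sub[OF g_less] f[OF g_less] by blast
    qed
    have eH: "e \<subseteq> verts H" "card e = 2" if "e \<in> edges H" for e
      using simpH that by (auto simp: simple_graph_def)
    have q_edge: "q ` e \<in> E" if "e \<in> edges H" for e
      using eH[OF that] q_verts card_image[OF inj_on_subset[OF q_inj eH(1)[OF that]]]
      unfolding E_def by auto
    have q_rk: "w (q ` e) = (rk e, Min (q ` e), Max (q ` e))" if "e \<in> edges H" for e
    proof -
      have "(h \<circ> p) ` q ` e = e" using eH(1)[OF that] hpq by (force simp: image_image)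
      then show ?thesis by (simp add: w_def)
    qed
    obtain C where C: "eo_copy C H K" "edges C = (`) q ` edges H"
    proof (rule eo_copy_image[OF assms(4) K q_inj])
      show "q ` verts H \<subseteq> verts K" using q_verts by (simp add: K_def)
      show "q ` e \<in> edges K" if "e \<in> edges H" for e using q_edge[OF that] by (simp add: K_def)
      show "(q ` e, q ` e') \<in> eord K" if "(e, e') \<in> eord H" for e e'
      proof -
        \<comment> \<open>Different edges of \<open>H\<close> are already separated by rank, so the
          positions chosen inside the blocks cannot disturb the order.\<close>
        have "rk e < rk e'"
          unfolding rk_def using strict_order_rank_less[OF finE ordH linH that] .
        moreover have "e \<in> edges H" "e' \<in> edges H" using ordH that by auto
        ultimately show ?thesis using q_edge q_rk by (simp add: K_def less_prod_def)
      qed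
    qed
    have "c e = Red" if e: "e \<in> edges C" for e
    proof -
      obtain e0 where e0: "e0 \<in> edges H" "e = q ` e0" using e C(2) by auto
      then obtain u v where "e0 = {u, v}" "u \<noteq> v" by (meson eH(2) card_2_iff)
      with e0 have uv: "{u, v} \<in> edges H" "u \<noteq> v" "e = {q u, q v}" by auto
      have "u \<in> verts H" "v \<in> verts H" using eH(1)[OF uv(1)] by auto
      moreover from this have "g u \<noteq> g v" using uv(2) hg by metis
      \<comment> \<open>\<open>red\<close> speaks only of increasing index pairs, so it is
        instantiated for both orders of \<open>g u\<close> and \<open>g v\<close>.\<close>
      ultimately show ?thesis
        using red[of "g u" "g v"] red[of "g v" "g u"] g_less hg uv
        by (auto simp: adj_def R_def q_def insert_commute neq_iff)
    qed
    with C(1) show "\<exists>C. eo_copy C H K \<and> (\<forall>e\<in>edges C. c e = Red)" by blast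
  qed
  moreover have "complete_graph K" "verts K = {1..N}"
    by (simp_all add: complete_graph_def K_def E_def)
  moreover have "N > 0" using B assms(3) by (simp add: N_def)
  ultimately have "eo_ramsey H G \<le> enat N"
    unfolding eo_ramsey_def using K by (intro Inf_lower) blast
  then show ?thesis by (simp add: N_def B_def power2_eq_square ac_simps)
qed

end
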